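(* Let $X_t^1,\dots,X_t^N\in\mathbb R^d$, $t\ge 0$, be a solution of the deterministic system $$\frac{dX_t^i}{dt}=\lambda\sum_{k=1}^N\psi_t^k(X_t^k-X_t^i),\quad t>0,\qquad \psi_t^k:=\frac{e^{-\beta L(X_t^k)}}{\sum_{l=1}^Ne^{-\beta L(X_t^l)}},\qquad i,k=1,\dots,N,$$ with initial data $X_0^1,\dots,X_0^N\in\mathbb R^d$, and let $\mathcal D(\mathcal X_t):=\max_{1\le i,j\le N}|X_t^i-X_t^j|$. Then: (1) $\mathcal D(\mathcal X_t)\le e^{-\lambda t}\mathcal D(\mathcal X_0)$ for all $t\ge0$; (2) there exists a unique $X_\infty\in\mathbb R^d$ such that $\lim_{t\to\infty}X_t^i=X_\infty$ for all $i=1,\dots,N$.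
   Context: $N,d\ge1$, $\lambda>0$, $\beta>0$; $L:\mathbb R^d\to\mathbb R$ is locally Lipschitz continuous; $|\cdot|$ is the Euclidean norm. *)

theory Defs
  imports "HOL-Analysis.Analysis"
begin

text \<open>
  The particles are indexed by \<open>{1..N}\<close>: \<open>X i t\<close> is the position of particle \<open>i\<close> at time \<open>t\<close>.
\<close>

text \<open>\<open>local_lipschitz\<close> is stated for time-dependent families; here the family is constant in time.\<close>

definition locally_lipschitz :: "('a::metric_space \<Rightarrow> 'b::metric_space) \<Rightarrow> bool" where
  "locally_lipschitz f \<longleftrightarrow> local_lipschitz (UNIV :: real set) UNIV (\<lambda>_. f)"

definition cbo_weight ::
    "nat \<Rightarrow> real \<Rightarrow> (real ^ 'd \<Rightarrow> real) \<Rightarrow> (nat \<Rightarrow> real \<Rightarrow> real ^ 'd) \<Rightarrow> nat \<Rightarrow> real \<Rightarrow> real" where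
  "cbo_weight N \<beta> L X k t =
     exp (- \<beta> * L (X k t)) / (\<Sum>l=1..N. exp (- \<beta> * L (X l t)))"

text \<open>
  The equation is imposed for \<open>t > 0\<close> only; continuity on \<open>[0,\<infinity>)\<close> is what ties the
  trajectories to their initial data \<open>X i 0\<close>. Values at negative times are unconstrained.
\<close>

definition cbo_solution ::
    "nat \<Rightarrow> real \<Rightarrow> real \<Rightarrow> (real ^ 'd \<Rightarrow> real) \<Rightarrow> (nat \<Rightarrow> real \<Rightarrow> real ^ 'd) \<Rightarrow> bool" where
  "cbo_solution N lam \<beta> L X \<longleftrightarrow>
     (\<forall>i\<in>{1..N}.
        continuous_on {0..} (X i) \<and>
        (\<forall>t>0. (X i has_vector_derivative
                  lam *\<^sub>R (\<Sum>k=1..N. cbo_weight N \<beta> L X k t *\<^sub>R (X k t - X i t))) (at t)))"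

definition ensemble_diameter :: "nat \<Rightarrow> (nat \<Rightarrow> real \<Rightarrow> real ^ 'd) \<Rightarrow> real \<Rightarrow> real" where
  "ensemble_diameter N X t =
     Max ((\<lambda>(i, j). norm (X i t - X j t)) ` ({1..N} \<times> {1..N}))"

end

theory Submission
  imports Defs "HOL-Real_Asymp.Real_Asymp"
begin

text \<open>
  The weights sum to one, so \<open>X\<^sup>i - X\<^sup>j\<close> solves the linear equation \<open>g' = -\<lambda> g\<close> and decays exactly
  like \<open>exp (-\<lambda>t)\<close>. The speed of each particle is therefore at most \<open>\<lambda> D\<^sub>0 exp (-\<lambda>t)\<close>, where
  \<open>D\<^sub>0\<close> is the initial diameter. This is integrable, so each particle converges, and all limits
  agree because the differences vanish.
\<close>

text \<open>Integrating factor: \<open>exp (c * t) *\<^sub>R g t\<close> has derivative zero for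
  positive \<open>t\<close>, and continuity up to 0 identifies its constant value as
  \<open>g 0\<close>.\<close>

lemma linear_decay_explicit:
  fixes g :: "real \<Rightarrow> 'a::real_normed_vector"
  assumes cont: "continuous_on {0..} g"
    and deriv: "\<And>t. t > 0 \<Longrightarrow> (g has_vector_derivative (- c) *\<^sub>R g t) (at t)"
    and "t \<ge> 0"
  shows "g t = exp (- c * t) *\<^sub>R g 0"
proof (cases "t = 0")
  case False
  with \<open>t \<ge> 0\<close> have "0 < t" by simp
  define h where "h s = exp (c * s) *\<^sub>R g s" for s
  \<comment> \<open>The right-hand side is the increment of the zero function, which serves as the
    comparison function in the mean value inequality; this forces \<open>h t = h 0\<close>.\<close>
  have "norm (h t - h 0) \<le> 0 - (0::real)"
  proof (rule differentiable_bound_general[OF \<open>0 < t\<close>])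
    show "continuous_on {0..t} h"
      unfolding h_def by (intro continuous_intros continuous_on_subset[OF cont]) auto
    show "(h has_vector_derivative 0) (at s)" if "0 < s" for s
      unfolding h_def
      by (rule has_vector_derivative_eq_rhs,
          (rule derivative_intros has_vector_derivative_scaleR deriv[OF that] refl)+)
         (simp add: algebra_simps)
  qed (auto intro!: derivative_eq_intros)
  then have "h t = g 0" by (simp add: h_def)
  then have "exp (- c * t) *\<^sub>R g 0 = (exp (- c * t) * exp (c * t)) *\<^sub>R g t"
    by (simp add: h_def flip: scaleR_scaleR)
  then show ?thesis by (simp flip: exp_add)
qed simp

text \<open>The speed bound is the derivative of a function with a finite limit at infinity.
  Increments of \<open>f\<close> are dominated by increments of that function, so completeness of
  the space yields a limit.\<close>

lemma convergent_if_exp_decaying_speed: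
  fixes f :: "real \<Rightarrow> 'a::banach"
  assumes "c > 0"
    and cont: "continuous_on {0..} f"
    and deriv: "\<And>t. t > 0 \<Longrightarrow> (f has_vector_derivative f' t) (at t)"
    and speed: "\<And>t. t > 0 \<Longrightarrow> norm (f' t) \<le> c * (C * exp (- c * t))"
  obtains l where "(f \<longlongrightarrow> l) at_top"
proof -
  \<comment> \<open>This is the antiderivative of the speed bound that vanishes at infinity, so
    \<open>- \<phi> t\<close> bounds the distance still to be travelled after time
    \<open>t\<close>.\<close>
  define \<phi> where "\<phi> t = - C * exp (- c * t)" for t
  have incr: "norm (f b - f a) \<le> \<phi> b - \<phi> a" if "0 \<le> a" "a \<le> b" for a b
  proof (cases "a = b")
    case False
    with that have "a < b" by simp
    then show ?thesis
    proof (rule differentiable_bound_general)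
      show "continuous_on {a..b} f"
        by (rule continuous_on_subset[OF cont]) (use that in auto)
      show "continuous_on {a..b} \<phi>"
        unfolding \<phi>_def by (intro continuous_intros)
      show "(\<phi> has_vector_derivative c * (C * exp (- c * x))) (at x)" for x
        unfolding \<phi>_def has_real_derivative_iff_has_vector_derivative[symmetric]
        by (auto intro!: derivative_eq_intros)
    qed (use that in \<open>auto intro: deriv speed[simplified]\<close>)
  qed simp
  have \<phi>_lim: "(\<phi> \<longlongrightarrow> 0) at_top"
    unfolding \<phi>_def using \<open>c > 0\<close> by real_asymp
  \<comment> \<open>Sampling at integer times only produces a candidate limit \<open>l\<close>;
    convergence along all real times is recovered afterwards.\<close>
  have "Cauchy (\<lambda>n. f (real n))"
  proof (rule CauchyI')
    fix e :: real assume "e > 0"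
    have "Cauchy (\<lambda>n. \<phi> (real n))"
      using filterlim_compose[OF \<phi>_lim filterlim_real_sequentially]
      by (rule LIMSEQ_imp_Cauchy)
    then obtain M where M: "\<And>m n. m \<ge> M \<Longrightarrow> n \<ge> M \<Longrightarrow> norm (\<phi> (real m) - \<phi> (real n)) < e"
      using CauchyD[OF _ \<open>e > 0\<close>] by blast
    have "dist (f (real m)) (f (real n)) < e" if "m \<ge> M" "n > m" for m n
      using incr[of "real m" "real n"] M[of n m] that
      by (simp add: dist_norm norm_minus_commute)
    then show "\<exists>M. \<forall>m\<ge>M. \<forall>n>m. dist (f (real m)) (f (real n)) < e" by blast
  qed
  then obtain l where l: "(\<lambda>n. f (real n)) \<longlonglongrightarrow> l"
    using Cauchy_convergent_iff convergent_def by blast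
  \<comment> \<open>Fix \<open>t\<close> and let \<open>n\<close> tend to infinity in
    \<open>incr\<close> applied to \<open>t\<close> and \<open>real n\<close>.\<close>
  have "norm (f t - l) \<le> - \<phi> t" if "t \<ge> 0" for t
  proof -
    have "(\<lambda>n. norm (f (real n) - f t)) \<longlonglongrightarrow> norm (l - f t)"
      by (intro tendsto_intros l)
    moreover have "(\<lambda>n. \<phi> (real n) - \<phi> t) \<longlonglongrightarrow> 0 - \<phi> t"
      by (intro tendsto_intros filterlim_compose[OF \<phi>_lim filterlim_real_sequentially])
    moreover have "\<forall>\<^sub>F n in sequentially. norm (f (real n) - f t) \<le> \<phi> (real n) - \<phi> t"
      using eventually_compose_filterlim[OF eventually_ge_at_top[of t] filterlim_real_sequentially]
      by eventually_elim (rule incr[OF that])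
    ultimately have "norm (l - f t) \<le> 0 - \<phi> t"
      by (intro tendsto_le[OF sequentially_bot])
    then show ?thesis by (simp add: norm_minus_commute)
  qed
  then have "((\<lambda>t. f t - l) \<longlongrightarrow> 0) at_top"
    by (intro Lim_null_comparison[OF _ tendsto_minus[OF \<phi>_lim, simplified]])
       (auto intro: eventually_mono[OF eventually_ge_at_top[of 0]])
  then show ?thesis
    using that LIM_zero_iff by blast
qed

lemma sum_cbo_weight:
  assumes "N \<ge> 1"
  shows "(\<Sum>k=1..N. cbo_weight N \<beta> L X k t) = 1"
proof -
  have "(\<Sum>l=1..N. exp (- \<beta> * L (X l t))) > 0"
    using assms by (intro sum_pos) auto
  then show ?thesis
    unfolding cbo_weight_def sum_divide_distrib[symmetric] by simp
qed

lemma cbo_weight_nonneg: "cbo_weight N \<beta> L X k t \<ge> 0"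
  unfolding cbo_weight_def by (intro divide_nonneg_nonneg sum_nonneg) auto

lemma norm_diff_le_ensemble_diameter:
  assumes "i \<in> {1..N}" "j \<in> {1..N}"
  shows "norm (X i t - X j t) \<le> ensemble_diameter N X t"
  unfolding ensemble_diameter_def using assms by (intro Max_ge) auto

lemma ensemble_diameter_le:
  assumes "N \<ge> 1"
    and "\<And>i j. i \<in> {1..N} \<Longrightarrow> j \<in> {1..N} \<Longrightarrow> norm (X i t - X j t) \<le> B"
  shows "ensemble_diameter N X t \<le> B"
  unfolding ensemble_diameter_def using assms by (intro Max.boundedI) auto

text \<open>The weights are the same for every particle, so subtracting two equations cancels the
  terms \<open>X k\<close>. As the weights sum to one, what remains is the linear equation with rate
  \<open>lam\<close>, however the weights vary in time.\<close>

lemma cbo_solution_diff: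
  assumes "N \<ge> 1" and sol: "cbo_solution N lam \<beta> L X"
    and ij: "i \<in> {1..N}" "j \<in> {1..N}" and "t \<ge> 0"
  shows "X i t - X j t = exp (- lam * t) *\<^sub>R (X i 0 - X j 0)"
proof (rule linear_decay_explicit[OF _ _ \<open>t \<ge> 0\<close>])
  show "continuous_on {0..} (\<lambda>t. X i t - X j t)"
    using sol ij unfolding cbo_solution_def by (intro continuous_intros) auto
  fix s :: real assume "s > 0"
  let ?w = "\<lambda>k. cbo_weight N \<beta> L X k s"
  have "lam *\<^sub>R (\<Sum>k=1..N. ?w k *\<^sub>R (X k s - X i s)) - lam *\<^sub>R (\<Sum>k=1..N. ?w k *\<^sub>R (X k s - X j s))
      = lam *\<^sub>R (\<Sum>k=1..N. ?w k *\<^sub>R (X j s - X i s))"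
    by (simp add: sum_subtractf algebra_simps)
  also have "\<dots> = - lam *\<^sub>R (X i s - X j s)"
    unfolding scaleR_sum_left[symmetric] sum_cbo_weight[OF \<open>N \<ge> 1\<close>] by (simp add: algebra_simps)
  finally have rhs: "lam *\<^sub>R (\<Sum>k=1..N. ?w k *\<^sub>R (X k s - X i s))
      - lam *\<^sub>R (\<Sum>k=1..N. ?w k *\<^sub>R (X k s - X j s)) = - lam *\<^sub>R (X i s - X j s)" .
  show "((\<lambda>t. X i t - X j t) has_vector_derivative - lam *\<^sub>R (X i s - X j s)) (at s)"
    unfolding rhs[symmetric] using sol ij \<open>s > 0\<close> unfolding cbo_solution_def
    by (intro has_vector_derivative_diff) auto
qed

text \<open>All pairwise distances shrink by one common factor, hence so does their maximum.\<close>

lemma cbo_solution_ensemble_diameter: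
  assumes "N \<ge> 1" "cbo_solution N lam \<beta> L X" "t \<ge> 0"
  shows "ensemble_diameter N X t \<le> exp (- lam * t) * ensemble_diameter N X 0"
proof (rule ensemble_diameter_le[OF \<open>N \<ge> 1\<close>])
  fix i j assume ij: "i \<in> {1..N}" "j \<in> {1..N}"
  have "norm (X i t - X j t) = exp (- lam * t) * norm (X i 0 - X j 0)"
    unfolding cbo_solution_diff[OF assms(1,2) ij \<open>t \<ge> 0\<close>] by simp
  also have "\<dots> \<le> exp (- lam * t) * ensemble_diameter N X 0"
    by (intro mult_left_mono norm_diff_le_ensemble_diameter ij) simp
  finally show "norm (X i t - X j t) \<le> exp (- lam * t) * ensemble_diameter N X 0" .
qed

text \<open>The velocity is \<open>lam\<close> times a convex combination of differences
  \<open>X k t - X i t\<close>, each bounded by the exponentially decaying diameter.\<close>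

lemma cbo_solution_convergent:
  assumes "N \<ge> 1" "lam > 0" and sol: "cbo_solution N lam \<beta> L X" and i: "i \<in> {1..N}"
  obtains l where "(X i \<longlongrightarrow> l) at_top"
proof (rule convergent_if_exp_decaying_speed[OF \<open>lam > 0\<close>])
  let ?f' = "\<lambda>t. lam *\<^sub>R (\<Sum>k=1..N. cbo_weight N \<beta> L X k t *\<^sub>R (X k t - X i t))"
  show "continuous_on {0..} (X i)" "\<And>t. t > 0 \<Longrightarrow> (X i has_vector_derivative ?f' t) (at t)"
    using sol i unfolding cbo_solution_def by auto
  fix t :: real assume "t > 0"
  let ?D = "exp (- lam * t) * ensemble_diameter N X 0"
  have "norm (\<Sum>k=1..N. cbo_weight N \<beta> L X k t *\<^sub>R (X k t - X i t))
      \<le> (\<Sum>k=1..N. cbo_weight N \<beta> L X k t * ?D)"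
  proof (rule sum_norm_le)
    fix k assume "k \<in> {1..N}"
    then have "norm (X k t - X i t) \<le> ?D"
      using norm_diff_le_ensemble_diameter[of k N i X t]
        cbo_solution_ensemble_diameter[OF \<open>N \<ge> 1\<close> sol, of t] i \<open>t > 0\<close> by simp
    then show "norm (cbo_weight N \<beta> L X k t *\<^sub>R (X k t - X i t)) \<le> cbo_weight N \<beta> L X k t * ?D"
      by (simp add: cbo_weight_nonneg mult_left_mono)
  qed
  also have "\<dots> = ?D"
    unfolding sum_distrib_right[symmetric] sum_cbo_weight[OF \<open>N \<ge> 1\<close>] by simp
  \<comment> \<open>The constant \<open>C\<close> of the convergence criterion is thus the initial
    diameter, with rate \<open>c = lam\<close>.\<close>
  finally show "norm (?f' t) \<le> lam * (ensemble_diameter N X 0 * exp (- lam * t))"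
    using \<open>lam > 0\<close> by (simp add: mult.commute)
qed (use that in blast)

theorem theorem3p1:
  fixes N :: nat and lam \<beta> :: real
    and L :: "real ^ 'd \<Rightarrow> real"
    and X :: "nat \<Rightarrow> real \<Rightarrow> real ^ 'd"
  assumes "N \<ge> 1" and "lam > 0" and "\<beta> > 0"
    and "locally_lipschitz L"
    and "cbo_solution N lam \<beta> L X"
  shows "(\<forall>t\<ge>0. ensemble_diameter N X t \<le> exp (- lam * t) * ensemble_diameter N X 0)
       \<and> (\<exists>!Xinf. \<forall>i\<in>{1..N}. (X i \<longlongrightarrow> Xinf) at_top)"
proof
  show "\<forall>t\<ge>0. ensemble_diameter N X t \<le> exp (- lam * t) * ensemble_diameter N X 0"
    using cbo_solution_ensemble_diameter assms by blast
  \<comment> \<open>Particle 1 serves as reference: its limit is the candidate for all particles,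
    and it alone already forces uniqueness.\<close>
  have one: "1 \<in> {1..N}" using \<open>N \<ge> 1\<close> by simp
  then obtain l where l: "(X 1 \<longlongrightarrow> l) at_top"
    using cbo_solution_convergent assms by blast
  have "(X i \<longlongrightarrow> l) at_top" if i: "i \<in> {1..N}" for i
  proof -
    have "((\<lambda>t. exp (- lam * t)) \<longlongrightarrow> 0) at_top"
      using \<open>lam > 0\<close> by real_asymp
    then have "((\<lambda>t. exp (- lam * t) *\<^sub>R (X i 0 - X 1 0)) \<longlongrightarrow> 0) at_top"
      using tendsto_scaleR[OF _ tendsto_const] by fastforce
    moreover have "\<forall>\<^sub>F t in at_top. exp (- lam * t) *\<^sub>R (X i 0 - X 1 0) = X i t - X 1 t"
      \<comment> \<open>The explicit formula for differences is available for nonnegative times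
        only, hence the passage to an eventual equality.\<close>
      using eventually_ge_at_top[of 0]
      by eventually_elim (rule cbo_solution_diff[OF assms(1,5) i one, symmetric])
    ultimately have "((\<lambda>t. X i t - X 1 t) \<longlongrightarrow> 0) at_top"
      by (rule Lim_transform_eventually)
    from tendsto_add[OF this l] show ?thesis by simp
  qed
  then show "\<exists>!Xinf. \<forall>i\<in>{1..N}. (X i \<longlongrightarrow> Xinf) at_top"
    using one tendsto_unique[OF trivial_limit_at_top_linorder l] by blast
qed

end
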